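(* Let $\mathcal{K}$ be a coronoid and let $C\subseteq G(\mathcal{K})$ be a cycle of length 6. Then every embedding (injective graph homomorphism) $C\hookrightarrow G(\mathcal{H})$ extends to an embedding $G(\mathcal{K})\hookrightarrow G(\mathcal{H})$ in a unique way.
   Context: $\mathcal{H}$ is the set of hexagons of the regular hexagonal tiling of the plane and $G(\mathcal{H})$ is the hexagonal lattice (the graph of vertices and edges of the tiling). Hexagons are adjacent if distinct and share an edge; a set of hexagons is connected if non-empty and any two of its hexagons are joined by a sequence of its hexagons with consecutive ones adjacent. A coronoid is a finite connected $\mathcal{K}\subseteq\mathcal{H}$, and $G(\mathcal{K})$ is the subgraph of $G(\mathcal{H})$ consisting of all vertices and edges lying on some hexagon of $\mathcal{K}$. *)

theory Defs
  imports Complex_Main "HOL-Library.FuncSet"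
begin

section \<open>Undirected graphs, subgraphs, cycles and embeddings\<close>

text \<open>Edges are two-element sets of vertices. This is not imposed on the record, but it holds for
  all the graphs considered here.\<close>

record 'a ugraph =
  verts :: "'a set"
  edges :: "'a set set"

definition subgraph :: "'a ugraph \<Rightarrow> 'a ugraph \<Rightarrow> bool" where
  "subgraph A B \<longleftrightarrow> verts A \<subseteq> verts B \<and> edges A \<subseteq> edges B"

definition is_cycle :: "nat \<Rightarrow> 'a ugraph \<Rightarrow> bool" where
  "is_cycle n C \<longleftrightarrow> n \<ge> 3 \<and> (\<exists>xs. length xs = n \<and> distinct xs \<and> verts C = set xs \<and>
     edges C = {{xs ! i, xs ! (Suc i mod n)} | i. i < n})"

text \<open>Embeddings are injective graph homomorphisms. They are taken to be extensional (with value
  \<open>undefined\<close> outside \<open>verts A\<close>), so that equality of embeddings is equality as maps on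
  \<open>verts A\<close>.\<close>

definition embeddings :: "'a ugraph \<Rightarrow> 'b ugraph \<Rightarrow> ('a \<Rightarrow> 'b) set" where
  "embeddings A B = {f \<in> verts A \<rightarrow>\<^sub>E verts B.
     inj_on f (verts A) \<and> (\<forall>e\<in>edges A. f ` e \<in> edges B)}"

section \<open>The regular hexagonal tiling of the plane\<close>

text \<open>The plane is the complex plane and the hexagons have side length 1. A hexagon is represented
  by its centre \<open>c\<close>; its corners are \<open>c + \<omega>^k\<close> for the primitive sixth root of unity \<open>\<omega>\<close>.
  Reflecting the hexagon with centre 0 in its sides gives the six hexagons with centres
  \<open>(1 + \<omega>) * \<omega>^k\<close>, and the lattice generated by these points (already by those with \<open>k = 0, 1\<close>) is
  the set of centres of all hexagons of the tiling.\<close>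

definition omega :: complex ("\<omega>") where
  "\<omega> = cis (pi / 3)"

definition hexagons :: "complex set" where
  "hexagons = {of_int a * (1 + \<omega>) + of_int b * ((1 + \<omega>) * \<omega>) | a b. True}"

definition hex_verts :: "complex \<Rightarrow> complex set" where
  "hex_verts c = {c + \<omega> ^ k | k. k < 6}"

definition hex_edges :: "complex \<Rightarrow> complex set set" where
  "hex_edges c = {{c + \<omega> ^ k, c + \<omega> ^ Suc k} | k. k < 6}"

definition hex_graph :: "complex set \<Rightarrow> complex ugraph" where
  "hex_graph K = \<lparr>verts = (\<Union>c\<in>K. hex_verts c), edges = (\<Union>c\<in>K. hex_edges c)\<rparr>"

section \<open>Coronoids\<close>

definition hex_adjacent :: "complex \<Rightarrow> complex \<Rightarrow> bool" where
  "hex_adjacent c d \<longleftrightarrow> c \<noteq> d \<and> hex_edges c \<inter> hex_edges d \<noteq> {}"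

definition hex_connected :: "complex set \<Rightarrow> bool" where
  "hex_connected K \<longleftrightarrow> K \<noteq> {} \<and>
     (\<forall>c\<in>K. \<forall>d\<in>K. (c, d) \<in> {(x, y). x \<in> K \<and> y \<in> K \<and> hex_adjacent x y}\<^sup>*)"

definition coronoid :: "complex set \<Rightarrow> bool" where
  "coronoid K \<longleftrightarrow> K \<subseteq> hexagons \<and> finite K \<and> hex_connected K"

end

theory Submission imports Defs begin

text \<open>Two local identities make embeddings rigid: the three neighbours of a vertex \<open>p\<close> sum to
  \<open>3 * p\<close>, and a closed non-backtracking walk \<open>x\<close> of length 6 satisfies
  \<open>x (i + 3) = x i + 2 * x (i + 2) - 2 * x (i + 1)\<close>. An embedding preserves both situations. Hence its
  values on a path \<open>p, q, r\<close> determine it on each hexagon of the coronoid containing the edge \<open>{p, q}\<close>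
  (whose next vertex after \<open>q\<close> is \<open>r\<close> or the third neighbour of \<open>q\<close>), and then, by connectedness,
  everywhere. This does not need the hexagon bounded by \<open>C\<close> to belong to \<open>K\<close>. For existence,
  automorphisms of the lattice act transitively on paths with three vertices, and two closed walks
  of length 6 with the same first three vertices coincide.\<close>

section \<open>Coordinates\<close>

lemma omega_eq: "\<omega> = Complex (1/2) (sqrt 3 / 2)"
  by (simp add: omega_def complex_eq_iff cos_60 sin_60)

lemma omega_square: "\<omega> * \<omega> = \<omega> - 1"
  by (simp add: omega_eq complex_eq_iff)

lemma cnj_omega: "cnj \<omega> = 1 - \<omega>"
  by (simp add: omega_eq complex_eq_iff)

lemma omega_powers:
  "\<omega> ^ 2 = \<omega> - 1" "\<omega> ^ 3 = -1" "\<omega> ^ 4 = - \<omega>" "\<omega> ^ 5 = 1 - \<omega>" "\<omega> ^ 6 = 1"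
proof -
  show 2: "\<omega> ^ 2 = \<omega> - 1"
    by (simp add: power2_eq_square omega_square)
  show 3: "\<omega> ^ 3 = -1"
    by (simp add: power3_eq_cube omega_square algebra_simps)
  show "\<omega> ^ 4 = - \<omega>"
    using power_add[of \<omega> 3 1] 3 by simp
  show "\<omega> ^ 5 = 1 - \<omega>"
    using power_add[of \<omega> 3 2] 2 3 by simp
  show "\<omega> ^ 6 = 1"
    using power_add[of \<omega> 3 3] 3 by simp
qed

lemma omega_power_mod_6: "\<omega> ^ (k mod 6) = \<omega> ^ k"
proof -
  have "\<omega> ^ k = \<omega> ^ (6 * (k div 6) + k mod 6)"
    by simp
  also have "\<dots> = \<omega> ^ (k mod 6)"
    by (simp only: power_add power_mult omega_powers power_one mult_1)
  finally show ?thesis by simp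
qed

text \<open>Coordinates of an Eisenstein integer in the basis \<open>1\<close>,
  \<open>\<omega>\<close>: equations between lattice points become integer equations and
  congruences.\<close>

definition eis :: "int \<Rightarrow> int \<Rightarrow> complex" where
  "eis a b = of_int a + of_int b * \<omega>"

lemma eis_eq_iff: "eis a b = eis a' b' \<longleftrightarrow> a = a' \<and> b = b'"
  by (auto simp: eis_def omega_eq complex_eq_iff)

lemma eis_arith:
  "eis a b + eis a' b' = eis (a + a') (b + b')"
  "eis a b - eis a' b' = eis (a - a') (b - b')"
  "- eis a b = eis (- a) (- b)"
  "of_int e * eis a b = eis (e * a) (e * b)"
  "\<omega> * eis a b = eis (- b) (a + b)"
  "cnj (eis a b) = eis (a + b) (- b)"
proof -
  have "\<omega> * eis a b = of_int a * \<omega> + of_int b * (\<omega> * \<omega>)"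
    by (simp add: eis_def algebra_simps)
  then show "\<omega> * eis a b = eis (- b) (a + b)"
    unfolding omega_square by (simp add: eis_def algebra_simps)
qed (simp_all add: eis_def algebra_simps cnj_omega)

text \<open>The centres form the ideal of the Eisenstein integers generated by
  \<open>1 + \<omega>\<close>, which has norm 3. Modulo this ideal \<open>\<omega>\<close> becomes
  \<open>-1\<close>, so the residue of \<open>a - b\<close> modulo 3 decides membership.\<close>

lemma hexagons_iff: "c \<in> hexagons \<longleftrightarrow> (\<exists>a b. c = eis a b \<and> 3 dvd a - b)"
proof
  have *: "of_int a * (1 + \<omega>) + of_int b * ((1 + \<omega>) * \<omega>) = eis (a - b) (a + 2 * b)" for a b
  proof -
    have "of_int a * (1 + \<omega>) + of_int b * ((1 + \<omega>) * \<omega>)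
        = of_int a * (1 + \<omega>) + of_int b * (\<omega> + \<omega> * \<omega>)"
      by (simp add: algebra_simps)
    then show ?thesis
      unfolding omega_square by (simp add: eis_def algebra_simps)
  qed
  {
    assume "c \<in> hexagons"
    then obtain a b where "c = eis (a - b) (a + 2 * b)"
      using * by (auto simp: hexagons_def)
    moreover have "3 dvd (a - b) - (a + 2 * b)"
      by (simp add: algebra_simps)
    ultimately show "\<exists>a b. c = eis a b \<and> 3 dvd a - b"
      by blast
  next
    assume "\<exists>a b. c = eis a b \<and> 3 dvd a - b"
    then obtain a b k where "c = eis a b" "a - b = 3 * k"
      by (auto elim: dvdE)
    \<comment> \<open>The coefficients solve \<open>m - n = a\<close> and
      \<open>m + 2 * n = b\<close>.\<close>
    then have "c = of_int (a - k) * (1 + \<omega>) + of_int (- k) * ((1 + \<omega>) * \<omega>)"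
      unfolding * by (simp add: eis_eq_iff)
    then show "c \<in> hexagons"
      unfolding hexagons_def by blast
  }
qed

section \<open>The hexagonal lattice\<close>

text \<open>The lattice is bipartite, with colour classes \<open>side 1\<close> and \<open>side (- 1)\<close>; the three edges at
  a vertex of \<open>side e\<close> point in the directions \<open>e * d\<close> with \<open>d \<in> dirs\<close>.\<close>

definition adj :: "complex \<Rightarrow> complex \<Rightarrow> bool" where
  "adj x y \<longleftrightarrow> {x, y} \<in> edges (hex_graph hexagons)"

definition side :: "int \<Rightarrow> complex set" where
  "side e = {eis a b | a b. 3 dvd a - b - e}"

definition dirs :: "complex set" where
  "dirs = {eis 1 0, eis (-1) 1, eis 0 (-1)}"

lemma adj_commute: "adj x y \<longleftrightarrow> adj y x"
  by (simp add: adj_def insert_commute)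

lemma adj_iff_hexagon:
  "adj x y \<longleftrightarrow> (\<exists>c\<in>hexagons. \<exists>k<6. {x, y} = {c + \<omega> ^ k, c + \<omega> ^ Suc k})"
  by (auto simp: adj_def hex_graph_def hex_edges_def)

lemma eis_side_iff: "eis a b \<in> side e \<longleftrightarrow> 3 dvd a - b - e"
  unfolding side_def by (auto simp: eis_eq_iff)

lemma less_6_cases:
  fixes k :: nat
  assumes "k < 6"
  obtains "k = 0" | "k = 1" | "k = 2" | "k = 3" | "k = 4" | "k = 5"
  using assms by linarith

text \<open>Corners of the hexagon about 0 alternate between the residues 1 and -1, so
  \<open>e\<close> is \<open>(-1) ^ k\<close>. As \<open>\<omega> - 1 = \<omega> ^ 2\<close>, the
  edge vector \<open>of_int e * d\<close> is \<open>\<omega> ^ (k + 2)\<close>.\<close>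

lemma omega_edge:
  assumes "k < 6"
  shows "\<exists>e\<in>{1, -1}. \<exists>s t. \<omega> ^ k = eis s t \<and> 3 dvd s - t - e \<and>
    (\<exists>d\<in>dirs. \<omega> ^ Suc k = \<omega> ^ k + of_int e * d)"
proof -
  have *: ?thesis if "e \<in> {1, -1}" "\<omega> ^ k = eis s t" "3 dvd s - t - e"
    "d \<in> dirs" "\<omega> ^ Suc k = \<omega> ^ k + of_int e * d" for e s t d
    using that by blast
  note powers = omega_powers omega_square eis_def dirs_def
  from assms show ?thesis
  proof (cases rule: less_6_cases)
    case 1 then show ?thesis by (intro *[of 1 1 0 "eis (-1) 1"]) (simp_all add: powers)
  next
    case 2 then show ?thesis by (intro *[of "-1" 0 1 "eis 1 0"]) (simp_all add: powers)
  next
    case 3 then show ?thesis by (intro *[of 1 "-1" 1 "eis 0 (-1)"])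
      (simp_all add: powers del: power_Suc)
  next
    case 4 then show ?thesis by (intro *[of "-1" "-1" 0 "eis (-1) 1"])
      (simp_all add: powers del: power_Suc)
  next
    case 5 then show ?thesis by (intro *[of 1 0 "-1" "eis 1 0"])
      (simp_all add: powers del: power_Suc)
  next
    case 6 then show ?thesis by (intro *[of "-1" 1 "-1" "eis 0 (-1)"])
      (simp_all add: powers del: power_Suc)
  qed
qed

text \<open>Every direction \<open>eis s t\<close> has \<open>s - t\<close> congruent to 1 modulo 3,
  so the step takes residue \<open>e\<close> to \<open>2 * e\<close>, which is congruent to
  \<open>- e\<close>.\<close>

lemma side_step:
  assumes "x \<in> side e" "e \<in> {1, -1}" "d \<in> dirs"
  shows "x + of_int e * d \<in> side (- e)"
proof -
  obtain a b where x: "x = eis a b" "3 dvd a - b - e"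
    using assms(1) by (auto simp: side_def)
  obtain s t where d: "d = eis s t" "(s, t) \<in> {(1, 0), (-1, 1), (0, -1)}"
    using assms(3) by (auto simp: dirs_def)
  have "3 dvd (a + e * s) - (b + e * t) - - e"
    using x(2) d(2) assms(2) by auto presburger+
  then show ?thesis
    unfolding side_def x(1) d(1) eis_arith by blast
qed

lemma side_disjoint: "x \<in> side 1 \<Longrightarrow> x \<notin> side (- 1)"
  unfolding side_def by (clarsimp simp: eis_eq_iff) presburger

text \<open>Replaces the geometry of the tiling by residues and directions. Translation by a centre
  changes no residue, so it suffices to inspect the hexagon about 0.\<close>

lemma adj_iff:
  "adj x y \<longleftrightarrow> (\<exists>e\<in>{1, -1}. x \<in> side e \<and> (\<exists>d\<in>dirs. y = x + of_int e * d))"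
proof
  assume "adj x y"
  then obtain c k where c: "c \<in> hexagons" and k: "k < 6"
    and xy: "{x, y} = {c + \<omega> ^ k, c + \<omega> ^ Suc k}"
    unfolding adj_iff_hexagon by blast
  obtain a b where ab: "c = eis a b" "3 dvd a - b"
    using c hexagons_iff by blast
  obtain e s t where "e \<in> {1, -1}" "\<omega> ^ k = eis s t" "3 dvd s - t - e"
    "\<exists>d\<in>dirs. \<omega> ^ Suc k = \<omega> ^ k + of_int e * d"
    using omega_edge[OF k] by blast
  moreover from this have "3 dvd (a + s) - (b + t) - e"
    using ab(2) by presburger
  ultimately have "\<exists>e\<in>{1, -1}. c + \<omega> ^ k \<in> side e \<and>
      (\<exists>d\<in>dirs. c + \<omega> ^ Suc k = c + \<omega> ^ k + of_int e * d)"
    unfolding ab(1) by (metis add.assoc eis_arith(1) eis_side_iff)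
  then obtain e d where e: "e \<in> {1, -1}" "c + \<omega> ^ k \<in> side e" "d \<in> dirs"
    "c + \<omega> ^ Suc k = c + \<omega> ^ k + of_int e * d"
    by blast
  from xy consider "x = c + \<omega> ^ k" "y = c + \<omega> ^ Suc k" | "y = c + \<omega> ^ k" "x = c + \<omega> ^ Suc k"
    by (auto simp: doubleton_eq_iff)
  then show "\<exists>e\<in>{1, -1}. x \<in> side e \<and> (\<exists>d\<in>dirs. y = x + of_int e * d)"
  proof cases
    case 1
    then show ?thesis using e by metis
  next
    case 2
    have "x \<in> side (- e)"
      using side_step[OF e(2,1,3)] unfolding 2 e(4) .
    moreover have "y = x + of_int (- e) * d"
      using e(4) 2 by simp
    moreover have "- e \<in> {1, -1}"
      using e(1) by auto
    ultimately show ?thesis using e(3) by blast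
  qed
next
  assume "\<exists>e\<in>{1, -1}. x \<in> side e \<and> (\<exists>d\<in>dirs. y = x + of_int e * d)"
  then obtain a b e d where e: "e \<in> {1, -1}" and x: "x = eis a b" "3 dvd a - b - e"
    and d: "d \<in> dirs" and y: "y = x + of_int e * d"
    unfolding side_def by blast
  \<comment> \<open>Of the two hexagons at the edge, take the one whose boundary runs
    counterclockwise from \<open>x\<close> to \<open>y\<close>; then \<open>k\<close> solves
    \<open>\<omega> ^ (k + 2) = of_int e * d\<close>.\<close>
  have "\<exists>k<6. x - \<omega> ^ k \<in> hexagons \<and> y = x - \<omega> ^ k + \<omega> ^ Suc k"
  proof -
    have "\<exists>k<6. \<exists>s t. 3 dvd (a - s) - (b - t) \<and> \<omega> ^ k = eis s t \<and> \<omega> ^ Suc k = eis s t + of_int e * d"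
    proof -
      have *: "\<exists>k<6. \<exists>s t. 3 dvd (a - s) - (b - t) \<and> \<omega> ^ k = eis s t \<and> \<omega> ^ Suc k = eis s t + of_int e * d"
        if "k < 6" "\<omega> ^ k = eis s t" "\<omega> ^ Suc k = eis s t + of_int e * d" "3 dvd s - t - e" for k s t
      proof -
        have "3 dvd (a - s) - (b - t)"
          using x(2) that(4) by presburger
        then show ?thesis using that by blast
      qed
      note powers = omega_powers omega_square eis_def
      have "e = 1 \<or> e = -1" "d = eis 1 0 \<or> d = eis (-1) 1 \<or> d = eis 0 (-1)"
        using e d by (auto simp: dirs_def)
      then consider "e = 1" "d = eis 1 0" | "e = 1" "d = eis (-1) 1" | "e = 1" "d = eis 0 (-1)"
        | "e = -1" "d = eis 1 0" | "e = -1" "d = eis (-1) 1" | "e = -1" "d = eis 0 (-1)"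
        by blast
      then show ?thesis
      proof cases
        case 1 then show ?thesis by (intro *[of 4 0 "-1"]) (simp_all add: powers del: power_Suc)
      next
        case 2 then show ?thesis by (intro *[of 0 1 0]) (simp_all add: powers)
      next
        case 3 then show ?thesis by (intro *[of 2 "-1" 1]) (simp_all add: powers del: power_Suc)
      next
        case 4 then show ?thesis by (intro *[of 1 0 1]) (simp_all add: powers)
      next
        case 5 then show ?thesis by (intro *[of 3 "-1" 0]) (simp_all add: powers del: power_Suc)
      next
        case 6 then show ?thesis by (intro *[of 5 1 "-1"]) (simp_all add: powers del: power_Suc)
      qed
    qed
    then show ?thesis
      unfolding y x(1) hexagons_iff by (force simp: eis_arith)
  qed
  then show "adj x y"
    unfolding adj_iff_hexagon by (metis diff_add_cancel)
qed

section \<open>Edge directions at a vertex and along a closed walk\<close>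

lemma adj_side:
  assumes "adj x y" "x \<in> side e" "e \<in> {1, -1}"
  shows "y \<in> side (- e)" "of_int e * (y - x) \<in> dirs"
proof -
  obtain e' d where e': "e' \<in> {1, -1}" "x \<in> side e'" "d \<in> dirs" "y = x + of_int e' * d"
    using assms(1) adj_iff by blast
  have "e' = e"
    using e'(1,2) assms(2,3) side_disjoint[of x] by auto
  then show "y \<in> side (- e)" "of_int e * (y - x) \<in> dirs"
    using side_step[OF e'(2,1,3)] e' by auto
qed

text \<open>The directions are the three cube roots of unity.\<close>

lemma dirs_sum_distinct:
  assumes "d \<in> dirs" "d' \<in> dirs" "d'' \<in> dirs" "d \<noteq> d'" "d \<noteq> d''" "d' \<noteq> d''"
  shows "d + d' + d'' = 0"
  using assms unfolding dirs_def by (auto simp: eis_arith) (auto simp: eis_def)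

lemma neighbours_sum:
  assumes "adj p q" "adj p r" "adj p t" "q \<noteq> r" "q \<noteq> t" "r \<noteq> t"
  shows "q + r + t = 3 * p"
proof -
  obtain e where e: "e \<in> {1, -1}" "p \<in> side e"
    using assms(1) adj_iff by blast
  have "of_int e * (q - p) + of_int e * (r - p) + of_int e * (t - p) = 0"
    using e assms by (intro dirs_sum_distinct adj_side) auto
  then have "of_int e * (q + r + t - 3 * p) = 0"
    by (simp add: algebra_simps)
  then show ?thesis using e(1) by auto
qed

text \<open>The \<open>s0\<close>, ..., \<open>s5\<close> stand for the steps of a closed walk with
  the alternating signs removed, and cyclically consecutive ones differ because the walk does not
  backtrack. Once \<open>s0 \<noteq> s2\<close> is known, the first three exhaust the
  directions.\<close>

lemma dirs_closed_hexagon: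
  assumes "s0 \<in> dirs" "s1 \<in> dirs" "s2 \<in> dirs" "s3 \<in> dirs" "s4 \<in> dirs" "s5 \<in> dirs"
    and "s0 \<noteq> s1" "s1 \<noteq> s2" "s2 \<noteq> s3" "s3 \<noteq> s4" "s4 \<noteq> s5" "s5 \<noteq> s0"
    and "s0 - s1 + s2 - s3 + s4 - s5 = 0"
  shows "s0 + s1 + s2 = 0"
proof -
  have "s0 \<noteq> s2"
  proof
    assume "s0 = s2"
    then have "s0 + s0 + s4 = s1 + s3 + s5"
      using assms(13) by (simp add: algebra_simps)
    moreover have s03: "s0 \<noteq> s3"
      using \<open>s0 = s2\<close> assms(9) by simp
    \<comment> \<open>Integer relations between the cube roots of unity have equal coefficients, so
      a sum of three directions determines the multiset of its summands. Here \<open>s0\<close>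
      occurs on the left but not on the right.\<close>
    moreover have "s0 + s0 + s4 \<noteq> s1 + s3 + s5"
      using assms(1,2,4,5,6) assms(7,12) s03 unfolding dirs_def
      by (elim insertE emptyE; hypsubst; simp add: eis_arith eis_eq_iff)
    ultimately show False by simp
  qed
  then show ?thesis
    using assms by (intro dirs_sum_distinct) auto
qed

section \<open>Closed walks of length six\<close>

text \<open>A periodic sequence on all natural numbers avoids indices modulo 6. The form covers
  boundaries of hexagons, cycles of length 6 and their images under embeddings.\<close>

definition hex_walk :: "(nat \<Rightarrow> complex) \<Rightarrow> bool" where
  "hex_walk x \<longleftrightarrow> (\<forall>i. x (i + 6) = x i \<and> x (i + 2) \<noteq> x i \<and> adj (x i) (x (Suc i)))"

lemma hex_walk_recurrence:
  assumes "hex_walk x"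
  shows "x (i + 3) = x i + 2 * x (i + 2) - 2 * x (i + 1)"
proof -
  have adj: "adj (x j) (x (Suc j))" and neq: "x (j + 2) \<noteq> x j" and per: "x (j + 6) = x j" for j
    using assms by (auto simp: hex_walk_def)
  obtain e where e: "e \<in> {1, -1}" "x i \<in> side e"
    using adj[of i] adj_iff by blast
  \<comment> \<open>Colours alternate along the walk, so multiplying by the sign at
    \<open>x (i + j)\<close> turns each step into an element of \<open>dirs\<close>.\<close>
  define s where "s j = of_int ((-1) ^ j * e) * (x (Suc (i + j)) - x (i + j))" for j
  have sign: "(-1) ^ j * e \<in> {1, -1}" for j
    using e(1) by (cases "even j") auto
  have side: "x (i + j) \<in> side ((-1) ^ j * e)" for j
  proof (induction j)
    case (Suc j)
    then show ?case
      using adj_side(1)[OF adj Suc sign] by simp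
  qed (simp add: e)
  have dirs: "s j \<in> dirs" for j
    unfolding s_def using adj_side(2)[OF adj side sign] .
  \<comment> \<open>Consecutive steps carry opposite signs, so equal directions would cancel and the
    walk would turn back.\<close>
  have "s j \<noteq> s (Suc j)" for j
  proof
    assume "s j = s (Suc j)"
    then have "of_int ((-1) ^ j * e) * (x (i + j + 2) - x (i + j)) = 0"
      by (simp add: s_def algebra_simps)
    then show False
      using sign[of j] neq[of "i + j"] by auto
  qed
  note step = this
  have s:
    "s 0 = of_int e * (x (i + 1) - x i)" "s 1 = - of_int e * (x (i + 2) - x (i + 1))"
    "s 2 = of_int e * (x (i + 3) - x (i + 2))" "s 3 = - of_int e * (x (i + 4) - x (i + 3))"
    "s 4 = of_int e * (x (i + 5) - x (i + 4))" "s 5 = - of_int e * (x i - x (i + 5))"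
    using per[of i] unfolding s_def by (simp_all add: eval_nat_numeral)
  \<comment> \<open>This closes the cycle of inequalities: \<open>s 5 \<noteq> s 6\<close> becomes
    \<open>s 5 \<noteq> s 0\<close>.\<close>
  have s6: "s 6 = s 0"
    using per[of i] per[of "Suc i"] unfolding s_def by simp
  have "s 0 + s 1 + s 2 = 0"
  proof (rule dirs_closed_hexagon[of "s 0" "s 1" "s 2" "s 3" "s 4" "s 5"])
    show "s 0 - s 1 + s 2 - s 3 + s 4 - s 5 = 0"
      unfolding s by (simp add: algebra_simps)
  qed (use dirs step[of 0] step[of 1] step[of 2] step[of 3] step[of 4] step[of 5] s6
      in \<open>simp_all add: eval_nat_numeral\<close>)
  then have "of_int e * (x (i + 3) - (x i + 2 * x (i + 2) - 2 * x (i + 1))) = 0"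
    unfolding s by (simp add: algebra_simps)
  then show ?thesis
    using e(1) by auto
qed

lemma hex_walk_eqI:
  assumes "hex_walk x" "hex_walk y" "x 0 = y 0" "x 1 = y 1" "x 2 = y 2"
  shows "x i = y i"
proof -
  \<comment> \<open>The recurrence has order three, so the induction carries three consecutive
    values.\<close>
  have "x i = y i \<and> x (i + 1) = y (i + 1) \<and> x (i + 2) = y (i + 2)"
  proof (induction i)
    case (Suc i)
    then show ?case
      using hex_walk_recurrence[OF assms(1), of i] hex_walk_recurrence[OF assms(2), of i]
      by (simp add: eval_nat_numeral)
  qed (use assms in \<open>simp add: numeral_2_eq_2\<close>)
  then show ?thesis by simp
qed

section \<open>Automorphisms of the hexagonal lattice\<close>

text \<open>Taken as bijections of the whole plane, so that composition and \<open>inv\<close> apply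
  without a carrier set.\<close>

definition hex_aut :: "(complex \<Rightarrow> complex) \<Rightarrow> bool" where
  "hex_aut A \<longleftrightarrow> bij A \<and> (\<forall>x y. adj (A x) (A y) \<longleftrightarrow> adj x y)"

lemma hex_autI:
  assumes "\<And>x. B (A x) = x" "\<And>x. A (B x) = x"
    and "\<And>x y. adj x y \<Longrightarrow> adj (A x) (A y)" "\<And>x y. adj x y \<Longrightarrow> adj (B x) (B y)"
  shows "hex_aut A"
  unfolding hex_aut_def using assms by (metis bijI')

lemma hex_aut_comp: "hex_aut A \<Longrightarrow> hex_aut B \<Longrightarrow> hex_aut (A \<circ> B)"
  by (auto simp: hex_aut_def intro: bij_comp)

lemma hex_aut_inv: "hex_aut A \<Longrightarrow> hex_aut (inv A)"
  unfolding hex_aut_def by (metis bij_imp_bij_inv bij_inv_eq_iff)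

section \<open>Translations, rotations and a reflection\<close>

lemma adj_translate:
  assumes "c \<in> hexagons" "adj x y"
  shows "adj (c + x) (c + y)"
proof -
  obtain m n where c: "c = eis m n" "3 dvd m - n"
    using assms(1) hexagons_iff by blast
  have "c + z \<in> side e" if z: "z \<in> side e" for z e
  proof -
    obtain a b where "z = eis a b" "3 dvd a - b - e"
      using z unfolding side_def by blast
    moreover from this have "3 dvd (m + a) - (n + b) - e"
      using c(2) by presburger
    ultimately show ?thesis
      by (simp add: c(1) eis_arith eis_side_iff)
  qed
  then show ?thesis
    using assms(2) unfolding adj_iff by (metis add.assoc)
qed

text \<open>Multiplication by \<open>\<omega>\<close> negates residues, hence exchanges the colour
  classes; \<open>- \<omega>\<close> is a cube root of unity and permutes
  \<open>dirs\<close>.\<close>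

lemma adj_omega: "adj x y \<Longrightarrow> adj (\<omega> * x) (\<omega> * y)"
proof -
  have "\<omega> * z \<in> side (- e)" if z: "z \<in> side e" for z e
  proof -
    obtain a b where "z = eis a b" "3 dvd a - b - e"
      using z unfolding side_def by blast
    moreover from this have "3 dvd (- b) - (a + b) - (- e)"
      by presburger
    ultimately show ?thesis
      by (simp only: eis_arith eis_side_iff)
  qed
  moreover assume "adj x y"
  then obtain e d where "e \<in> {1, -1}" "x \<in> side e" "d \<in> dirs" "y = x + of_int e * d"
    unfolding adj_iff by blast
  moreover have "- \<omega> * d \<in> dirs"
    using \<open>d \<in> dirs\<close> unfolding dirs_def by (auto simp: eis_arith eis_eq_iff)
  moreover have "- e \<in> {1, -1}" "\<omega> * y = \<omega> * x + of_int (- e) * (- \<omega> * d)"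
    using calculation by (auto simp: algebra_simps)
  ultimately show ?thesis
    unfolding adj_iff by blast
qed

text \<open>Conjugation preserves residues and permutes the cube roots of unity.\<close>

lemma adj_cnj: "adj x y \<Longrightarrow> adj (cnj x) (cnj y)"
proof -
  have "cnj z \<in> side e" if z: "z \<in> side e" for z e
  proof -
    obtain a b where "z = eis a b" "3 dvd a - b - e"
      using z unfolding side_def by blast
    moreover from this have "3 dvd (a + b) - (- b) - e"
      by presburger
    ultimately show ?thesis
      by (simp only: eis_arith eis_side_iff)
  qed
  moreover assume "adj x y"
  then obtain e d where "e \<in> {1, -1}" "x \<in> side e" "d \<in> dirs" "y = x + of_int e * d"
    unfolding adj_iff by blast
  moreover have "cnj d \<in> dirs"
    using \<open>d \<in> dirs\<close> unfolding dirs_def by (auto simp: eis_arith eis_eq_iff)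
  moreover have "cnj y = cnj x + of_int e * cnj d"
    using calculation by auto
  ultimately show ?thesis
    unfolding adj_iff by blast
qed

lemma adj_omega_power: "adj x y \<Longrightarrow> adj (\<omega> ^ k * x) (\<omega> ^ k * y)"
  by (induction k) (simp_all add: mult.assoc adj_omega)

lemma hex_aut_translate:
  assumes "c \<in> hexagons"
  shows "hex_aut (\<lambda>z. c + z)"
proof (rule hex_autI[where B = "\<lambda>z. - c + z"])
  have "- c \<in> hexagons"
  proof -
    obtain a b where "c = eis a b" "3 dvd a - b"
      using assms hexagons_iff by blast
    moreover from this have "3 dvd (- a) - (- b)"
      by presburger
    ultimately show ?thesis
      unfolding hexagons_iff by (metis eis_arith(3))
  qed
  then show "adj (- c + x) (- c + y)" if "adj x y" for x y
    using adj_translate that by blast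
qed (use adj_translate[OF assms] in auto)

lemma hex_aut_omega_power: "hex_aut (\<lambda>z. \<omega> ^ k * z)"
\<comment> \<open>Since \<open>\<omega> ^ 6 = 1\<close>, the exponent \<open>5 * k\<close> serves as
  \<open>- k\<close>.\<close>
proof (rule hex_autI[where B = "\<lambda>z. \<omega> ^ (5 * k) * z"])
  have "\<omega> ^ (5 * k) * \<omega> ^ k = 1" "\<omega> ^ k * \<omega> ^ (5 * k) = 1"
    using omega_power_mod_6[of "6 * k"] by (simp_all flip: power_add)
  then show "\<omega> ^ (5 * k) * (\<omega> ^ k * x) = x" "\<omega> ^ k * (\<omega> ^ (5 * k) * x) = x" for x
    by (simp_all flip: mult.assoc)
qed (rule adj_omega_power, assumption)+

lemma hex_aut_cnj: "hex_aut cnj"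
  by (rule hex_autI[where B = cnj]) (auto intro: adj_cnj)

section \<open>Transitivity on paths with three vertices\<close>

lemma side_minus_dir_hexagons:
  assumes "p \<in> side e" "e \<in> {1, -1}" "d \<in> dirs"
  shows "p - of_int e * d \<in> hexagons"
proof -
  obtain a b where p: "p = eis a b" "3 dvd a - b - e"
    using assms(1) unfolding side_def by blast
  obtain s t where d: "d = eis s t" "(s, t) \<in> {(1, 0), (-1, 1), (0, -1)}"
    using assms(3) by (auto simp: dirs_def)
  have "3 dvd (a - e * s) - (b - e * t)"
    using p(2) d(2) assms(2) by auto presburger+
  then show ?thesis
    unfolding hexagons_iff p(1) d(1) eis_arith by blast
qed

lemma signed_dirs_omega_power:
  assumes "e \<in> {1, -1}" "d \<in> dirs"
  shows "\<exists>k. of_int e * d = \<omega> ^ k"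
proof -
  have "of_int e * d \<in> {\<omega> ^ 0, \<omega> ^ 1, \<omega> ^ 2, \<omega> ^ 3, \<omega> ^ 4, \<omega> ^ 5}"
    using assms unfolding dirs_def omega_powers by (auto simp: eis_def)
  then show ?thesis by blast
qed

text \<open>The reference path \<open>\<omega>\<close>, \<open>1\<close>,
  \<open>cnj \<omega>\<close> runs along the hexagon about 0. A rotation and a translation carry it
  to the given path up to reversal, and conjugation reverses it.\<close>

lemma path_hex_aut:
  assumes "adj p q" "adj q r" "p \<noteq> r"
  obtains A where "hex_aut A" "A \<omega> = p" "A 1 = q" "A (cnj \<omega>) = r"
proof -
  obtain e where e: "e \<in> {1, -1}" "q \<in> side e"
    using assms(2) adj_iff by blast
  \<comment> \<open>The three directions sum to 0, so \<open>d''\<close> is the one at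
    \<open>q\<close> that the path does not use.\<close>
  define d d' d'' where "d = of_int e * (p - q)" and "d' = of_int e * (r - q)" and "d'' = - d - d'"
  have d: "d \<in> dirs" "d' \<in> dirs"
    using adj_side(2)[of q _ e] assms e by (auto simp: d_def d'_def adj_commute)
  have ne: "d \<noteq> d'"
    using assms(3) e(1) by (auto simp: d_def d'_def)
  have pr: "p = q + of_int e * d" "r = q + of_int e * d'"
    using e(1) by (auto simp: d_def d'_def)
  \<comment> \<open>Both \<open>- \<omega>\<close> and \<open>- cnj \<omega>\<close> are primitive
    cube roots of unity, so they take \<open>d''\<close> to the other two directions. The
    alternatives are the two orientations of the path.\<close>
  have cases: "d'' \<in> dirs \<and> (- \<omega> * d'' = d' \<and> - cnj \<omega> * d'' = d \<or> - \<omega> * d'' = d \<and> - cnj \<omega> * d'' = d')"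
  proof -
    have "cnj \<omega> * eis a b = eis (a + b) (- a)" for a b
    proof -
      have "cnj \<omega> * eis a b = eis a b - \<omega> * eis a b"
        unfolding cnj_omega by (simp add: algebra_simps)
      then show ?thesis by (simp add: eis_arith)
    qed
    then show ?thesis
      using d ne unfolding d''_def dirs_def by (auto simp: eis_arith eis_eq_iff)
  qed
  obtain k where k: "of_int e * d'' = \<omega> ^ k"
    using signed_dirs_omega_power e(1) cases by blast
  \<comment> \<open>the centre of the hexagon through \<open>p\<close>, \<open>q\<close> and \<open>r\<close>\<close>
  define c where "c = q - of_int e * d''"
  have c: "c \<in> hexagons"
    unfolding c_def using side_minus_dir_hexagons e cases by blast
  define A where "A = (\<lambda>z. c + z) \<circ> (\<lambda>z. \<omega> ^ k * z)"
  have A: "hex_aut A" "hex_aut (A \<circ> cnj)"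
    unfolding A_def by (intro hex_aut_comp hex_aut_translate hex_aut_omega_power hex_aut_cnj c)+
  have A_eq: "A z = q + of_int e * (z * d'' - d'')" for z
    unfolding A_def c_def using k by (simp add: algebra_simps)
  have unit: "\<omega> * d'' - d'' = - cnj \<omega> * d''" "cnj \<omega> * d'' - d'' = - \<omega> * d''"
    unfolding cnj_omega by (simp_all add: algebra_simps)
  have "A 1 = q"
    by (simp add: A_eq)
  moreover have "A \<omega> = p \<and> A (cnj \<omega>) = r \<or> A \<omega> = r \<and> A (cnj \<omega>) = p"
    unfolding A_eq unit pr using cases by metis
  ultimately show thesis
    using that[OF A(1)] that[OF A(2)] by auto
qed

lemma hex_aut_transitive:
  assumes "adj p q" "adj q r" "p \<noteq> r" and "adj p' q'" "adj q' r'" "p' \<noteq> r'"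
  obtains A where "hex_aut A" "A p = p'" "A q = q'" "A r = r'"
proof -
  obtain A where A: "hex_aut A" "A \<omega> = p" "A 1 = q" "A (cnj \<omega>) = r"
    using path_hex_aut[OF assms(1-3)] by blast
  obtain B where B: "hex_aut B" "B \<omega> = p'" "B 1 = q'" "B (cnj \<omega>) = r'"
    using path_hex_aut[OF assms(4-6)] by blast
  have "bij A"
    using A(1) by (simp add: hex_aut_def)
  then have "inv A p = \<omega>" "inv A q = 1" "inv A r = cnj \<omega>"
    using A(2-4) by (auto simp: bij_is_inj)
  then show thesis
    using that[OF hex_aut_comp[OF B(1) hex_aut_inv[OF A(1)]]] B by simp
qed

section \<open>Hexagons and embeddings\<close>

lemma omega_power_hex_verts: "c + \<omega> ^ m \<in> hex_verts c"
  unfolding hex_verts_def using omega_power_mod_6[of m]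
  by (intro CollectI exI[of _ "m mod 6"]) simp

lemma hex_edges_walk:
  assumes "c \<in> hexagons" "{p, q} \<in> hex_edges c"
  obtains x where "hex_walk x" "x 0 = p" "x 1 = q" "range x = hex_verts c"
    "\<And>i. {x i, x (Suc i)} \<in> hex_edges c"
proof -
  obtain k where k: "{p, q} = {c + \<omega> ^ k, c + \<omega> ^ Suc k}"
    using assms(2) unfolding hex_edges_def by blast
  have reduce: "\<omega> ^ (6 * m + n) = \<omega> ^ n" for m n
    by (simp add: power_add power_mult omega_powers)
  have edge: "{c + \<omega> ^ m, c + \<omega> ^ Suc m} \<in> hex_edges c" for m
    unfolding hex_edges_def
    by (intro CollectI exI[of _ "m mod 6"]) (simp add: omega_power_mod_6)
  \<comment> \<open>The edge is unordered, so the walk may have to run either way: exponents grow by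
    1 for counterclockwise and by 5, that is -1 modulo 6, for clockwise.\<close>
  obtain a m where m: "m = 1 \<or> m = 5" and pq: "p = c + \<omega> ^ a" "q = c + \<omega> ^ (a + m)"
  proof -
    have "\<omega> ^ (Suc k + 5) = \<omega> ^ k"
      using reduce[of 1 k] by (simp add: add.commute)
    moreover have "p = c + \<omega> ^ k \<and> q = c + \<omega> ^ (k + 1) \<or> p = c + \<omega> ^ Suc k \<and> q = c + \<omega> ^ k"
      using k by (auto simp: doubleton_eq_iff)
    ultimately show thesis
      using that[of 1 k] that[of 5 "Suc k"] by metis
  qed
  define x where "x i = c + \<omega> ^ (a + m * i)" for i
  have edges: "{x i, x (Suc i)} \<in> hex_edges c" for i
    using m
  proof
    assume "m = 1"
    then show ?thesis
      using edge[of "a + i"] by (simp add: x_def)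
  next
    assume "m = 5"
    moreover have "\<omega> ^ (a + 5 * i) = \<omega> ^ Suc (a + 5 * Suc i)"
      using reduce[of 1 "a + 5 * i"] by (simp add: algebra_simps)
    ultimately show ?thesis
      using edge[of "a + 5 * Suc i"] unfolding x_def by (metis insert_commute)
  qed
  have "hex_walk x"
    unfolding hex_walk_def
  proof (intro allI conjI)
    fix i
    show "x (i + 6) = x i"
      using reduce[of m "a + m * i"] by (simp add: x_def algebra_simps)
    have "\<omega> ^ (m * 2) \<noteq> 1"
      using m reduce[of 1 4] omega_powers by (auto simp: omega_eq complex_eq_iff)
    moreover have "\<omega> ^ (a + m * (i + 2)) = \<omega> ^ (a + m * i) * \<omega> ^ (m * 2)"
      by (simp only: distrib_left power_add mult.assoc)
    moreover have "\<omega> ^ n \<noteq> 0" for n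
      by (simp add: omega_def)
    ultimately show "x (i + 2) \<noteq> x i"
      unfolding x_def by (metis add_left_cancel mult_cancel_left2)
    show "adj (x i) (x (Suc i))"
      using edges assms(1) unfolding adj_def hex_graph_def by auto
  qed
  moreover have "range x = hex_verts c"
  proof (intro equalityI subsetI)
    fix v assume "v \<in> range x"
    then show "v \<in> hex_verts c"
      unfolding x_def using omega_power_hex_verts by blast
  next
    fix v assume "v \<in> hex_verts c"
    then obtain j where v: "v = c + \<omega> ^ j"
      by (auto simp: hex_verts_def)
    \<comment> \<open>As \<open>m * m\<close> is 1 modulo 6, the index
      \<open>m * (j + 5 * a)\<close> advances the exponent by \<open>j - a\<close> modulo 6.\<close>
    have "\<omega> ^ (a + m * (m * (j + 5 * a))) = \<omega> ^ j"
      using m reduce[of a j] reduce[of "4 * j + 21 * a" j] by (auto simp: algebra_simps)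
    then show "v \<in> range x"
      unfolding v x_def by (intro image_eqI[of _ _ "m * (j + 5 * a)"]) auto
  qed
  ultimately show thesis
    using that[of x] edges pq by (simp add: x_def)
qed

lemma edges_hex_graph_mono: "K \<subseteq> L \<Longrightarrow> edges (hex_graph K) \<subseteq> edges (hex_graph L)"
  by (auto simp: hex_graph_def)

lemma vertex_of_edge:
  assumes "{x, y} \<in> edges (hex_graph K)"
  shows "y \<in> verts (hex_graph K)"
proof -
  obtain c k where c: "c \<in> K" "{x, y} = {c + \<omega> ^ k, c + \<omega> ^ Suc k}"
    using assms unfolding hex_graph_def hex_edges_def by auto
  have "y = c + \<omega> ^ k \<or> y = c + \<omega> ^ Suc k"
    using c(2) by (auto simp: doubleton_eq_iff)
  then have "y \<in> hex_verts c"
    using omega_power_hex_verts by blast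
  then show ?thesis
    using c(1) by (auto simp: hex_graph_def)
qed

section \<open>Rigidity of embeddings\<close>

lemma embedding_adj:
  assumes "g \<in> embeddings G (hex_graph hexagons)" "{x, y} \<in> edges G"
  shows "adj (g x) (g y)"
proof -
  have "g ` {x, y} \<in> edges (hex_graph hexagons)"
    using assms unfolding embeddings_def by blast
  then show ?thesis
    by (simp add: adj_def)
qed

text \<open>Injectivity keeps the image from backtracking.\<close>

lemma embedding_hex_walk:
  assumes "g \<in> embeddings G (hex_graph hexagons)" "hex_walk x"
    and "\<And>i. {x i, x (Suc i)} \<in> edges G" "range x \<subseteq> verts G"
  shows "hex_walk (g \<circ> x)"
proof -
  have "inj_on g (verts G)"
    using assms(1) by (simp add: embeddings_def)
  then have "g (x (i + 2)) \<noteq> g (x i)" for i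
    using assms(2,4) unfolding hex_walk_def by (metis inj_onD rangeI subsetD)
  then show ?thesis
    using assms(2) embedding_adj[OF assms(1,3)] by (simp add: hex_walk_def)
qed

text \<open>A walk round \<open>d\<close> is fixed by its first three values, of which
  \<open>p\<close> and \<open>q\<close> supply two. The vertex \<open>r\<close> may lie off
  \<open>d\<close>, so that any path beginning with an edge of \<open>d\<close> can be used.\<close>

lemma embeddings_agree_hexagon:
  assumes g: "g \<in> embeddings (hex_graph K) (hex_graph hexagons)"
    and h: "h \<in> embeddings (hex_graph K) (hex_graph hexagons)"
    and "d \<in> K" "K \<subseteq> hexagons"
    and pq: "{p, q} \<in> hex_edges d" and qr: "{q, r} \<in> edges (hex_graph K)" and "p \<noteq> r"
    and agree: "g p = h p" "g q = h q" "g r = h r"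
    and "v \<in> hex_verts d"
  shows "g v = h v"
proof -
  let ?G = "hex_graph K"
  obtain x where x: "hex_walk x" "x 0 = p" "x 1 = q" "range x = hex_verts d"
    and x_edge: "\<And>i. {x i, x (Suc i)} \<in> hex_edges d"
    using hex_edges_walk pq \<open>d \<in> K\<close> \<open>K \<subseteq> hexagons\<close> by blast
  have edge: "{x i, x (Suc i)} \<in> edges ?G" for i
    using x_edge[of i] \<open>d \<in> K\<close> by (auto simp: hex_graph_def)
  have range: "range x \<subseteq> verts ?G"
    using x(4) \<open>d \<in> K\<close> by (auto simp: hex_graph_def)
  have "x 2 \<noteq> p"
    using x(1,2) by (metis add_0 hex_walk_def)
  \<comment> \<open>If \<open>x 2\<close> differs from \<open>r\<close>, then \<open>p\<close>,
    \<open>r\<close> and \<open>x 2\<close> are the three neighbours of \<open>q\<close>, and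
    \<open>f\<close> sends them to three distinct neighbours of \<open>f q\<close>. The value at
    \<open>x 2\<close> is then forced by the others.\<close>
  have sum: "f p + f r + f (x 2) = 3 * f q"
    if f: "f \<in> embeddings ?G (hex_graph hexagons)" and "x 2 \<noteq> r" for f
  proof (rule neighbours_sum)
    have "p \<in> verts ?G" "x 2 \<in> verts ?G"
      using range x(2) by auto
    moreover have "r \<in> verts ?G"
      using qr vertex_of_edge by blast
    moreover have "inj_on f (verts ?G)"
      using f by (simp add: embeddings_def)
    ultimately show "f p \<noteq> f r" "f p \<noteq> f (x 2)" "f r \<noteq> f (x 2)"
      using \<open>p \<noteq> r\<close> \<open>x 2 \<noteq> p\<close> \<open>x 2 \<noteq> r\<close> by (metis inj_onD)+
    show "adj (f q) (f p)" "adj (f q) (f r)" "adj (f q) (f (x 2))"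
      using embedding_adj[OF f qr] embedding_adj[OF f edge[of 0]] embedding_adj[OF f edge[of 1]] x(2,3)
      by (simp_all add: adj_commute numeral_2_eq_2)
  qed
  have "g (x 2) = h (x 2)"
  proof (cases "x 2 = r")
    case False
    then show ?thesis
      using sum[OF g] sum[OF h] agree by (metis add_left_cancel)
  qed (use agree in simp)
  then have "(g \<circ> x) i = (h \<circ> x) i" for i
    using agree x(2,3) hex_walk_eqI[OF embedding_hex_walk[OF g x(1) edge range]
        embedding_hex_walk[OF h x(1) edge range]] by simp
  then show ?thesis
    using \<open>v \<in> hex_verts d\<close> x(4) by (metis comp_apply imageE)
qed

text \<open>Agreement spreads from a hexagon containing \<open>{p, q}\<close> along chains of
  adjacent hexagons, crossing one shared edge at a time.\<close>

lemma embeddings_agree_path: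
  assumes g: "g \<in> embeddings (hex_graph K) (hex_graph hexagons)"
    and h: "h \<in> embeddings (hex_graph K) (hex_graph hexagons)"
    and K: "hex_connected K" "K \<subseteq> hexagons"
    and pq: "{p, q} \<in> edges (hex_graph K)" and qr: "{q, r} \<in> edges (hex_graph K)" and "p \<noteq> r"
    and agree: "g p = h p" "g q = h q" "g r = h r"
  shows "g = h"
proof -
  let ?R = "{(x, y). x \<in> K \<and> y \<in> K \<and> hex_adjacent x y}"
  obtain c where c: "c \<in> K" "{p, q} \<in> hex_edges c"
    using pq by (auto simp: hex_graph_def)
  have "\<forall>v\<in>hex_verts d. g v = h v" if "d \<in> K" for d
  proof -
    have "(c, d) \<in> ?R\<^sup>*"
      using K(1) c(1) that unfolding hex_connected_def by blast
    then show ?thesis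
    proof (induction rule: rtrancl_induct)
      case base
      then show ?case
        using embeddings_agree_hexagon[OF g h c(1) K(2) c(2) qr \<open>p \<noteq> r\<close> agree] by blast
    next
      case (step b d)
      then have bd: "b \<in> K" "d \<in> K" "hex_adjacent b d"
        by auto
      then obtain s t where st: "{s, t} \<in> hex_edges b" "{s, t} \<in> hex_edges d"
        unfolding hex_adjacent_def hex_edges_def by blast
      \<comment> \<open>Walking round \<open>b\<close> from the shared edge yields the vertex
        \<open>x 2\<close> after \<open>t\<close>; the path \<open>s\<close>, \<open>t\<close>,
        \<open>x 2\<close> lies in \<open>b\<close>, where agreement is known, and starts with an
        edge of \<open>d\<close>.\<close>
      obtain x where x: "hex_walk x" "x 0 = s" "x 1 = t" "range x = hex_verts b"
        and x_edge: "\<And>i. {x i, x (Suc i)} \<in> hex_edges b"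
        using hex_edges_walk st(1) bd(1) K(2) by blast
      have "x 2 \<noteq> s"
        using x(1,2) by (metis add_0 hex_walk_def)
      moreover have "{t, x 2} \<in> edges (hex_graph K)"
        using x_edge[of 1] x(3) bd(1) by (auto simp: hex_graph_def numeral_2_eq_2)
      moreover have "g s = h s" "g t = h t" "g (x 2) = h (x 2)"
        using step.IH x(2-4) by blast+
      ultimately show ?case
        using embeddings_agree_hexagon[OF g h bd(2) K(2) st(2)] by metis
    qed
  qed
  then have "g v = h v" if "v \<in> verts (hex_graph K)" for v
    using that by (auto simp: hex_graph_def)
  moreover have "g \<in> extensional (verts (hex_graph K))" "h \<in> extensional (verts (hex_graph K))"
    using g h by (auto simp: embeddings_def PiE_def)
  ultimately show ?thesis
    by (blast intro: extensionalityI)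
qed

section \<open>Existence of the extension and conclusion\<close>

lemma hex_aut_embedding:
  assumes "hex_aut A" "K \<subseteq> hexagons"
  shows "restrict A (verts (hex_graph K)) \<in> embeddings (hex_graph K) (hex_graph hexagons)"
proof -
  let ?V = "verts (hex_graph K)"
  have A: "{A x, A y} \<in> edges (hex_graph hexagons)" if "{x, y} \<in> edges (hex_graph K)" for x y
    using assms(1) that edges_hex_graph_mono[OF assms(2)] unfolding hex_aut_def adj_def by blast
  have "A v \<in> verts (hex_graph hexagons)" if v: "v \<in> ?V" for v
  proof -
    obtain c k where "c \<in> K" "k < 6" "v = c + \<omega> ^ k"
      using v by (auto simp: hex_graph_def hex_verts_def)
    \<comment> \<open>Automorphisms are specified through adjacency, so \<open>v\<close> is
      exhibited as an endpoint of an edge.\<close>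
    then have "{c + \<omega> ^ Suc k, v} \<in> edges (hex_graph K)"
      by (auto simp: hex_graph_def hex_edges_def)
    then show ?thesis
      using A vertex_of_edge by blast
  qed
  moreover have "inj_on A ?V"
    using assms(1) by (meson bij_betw_imp_inj_on hex_aut_def inj_on_subset subset_UNIV)
  moreover have "restrict A ?V ` e \<in> edges (hex_graph hexagons)" if e: "e \<in> edges (hex_graph K)" for e
  proof -
    obtain x y where xy: "e = {x, y}"
      using e by (auto simp: hex_graph_def hex_edges_def)
    then have "x \<in> ?V" "y \<in> ?V"
      using e vertex_of_edge by (auto simp: insert_commute)
    then have "restrict A ?V ` e = {A x, A y}"
      using xy by simp
    then show ?thesis
      using A e xy by simp
  qed
  ultimately show ?thesis
    by (simp add: embeddings_def)
qed

lemma cycle6_walk: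
  assumes "is_cycle 6 C" "subgraph C (hex_graph K)" "K \<subseteq> hexagons"
  obtains x where "hex_walk x" "range x = verts C" "\<And>i. {x i, x (Suc i)} \<in> edges C"
proof -
  obtain xs where xs: "length xs = 6" "distinct xs" "verts C = set xs"
    "edges C = {{xs ! i, xs ! (Suc i mod 6)} | i. i < 6}"
    using assms(1) unfolding is_cycle_def by blast
  define x where "x i = xs ! (i mod 6)" for i
  have edges: "{x i, x (Suc i)} \<in> edges C" for i
    unfolding xs(4) x_def by (intro CollectI exI[of _ "i mod 6"]) (simp add: mod_Suc_eq)
  moreover have "range x = verts C"
  proof (intro equalityI subsetI)
    fix v assume "v \<in> verts C"
    then obtain i where "i < 6" "v = xs ! i"
      using xs(1,3) by (auto simp: in_set_conv_nth)
    then show "v \<in> range x"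
      unfolding x_def by (intro image_eqI[of _ _ i]) auto
  next
    fix v assume "v \<in> range x"
    then obtain i where "v = xs ! (i mod 6)"
      unfolding x_def by blast
    moreover have "i mod 6 < length xs"
      unfolding xs(1) by simp
    ultimately show "v \<in> verts C"
      unfolding xs(3) by (simp only: nth_mem)
  qed
  moreover have "hex_walk x"
    unfolding hex_walk_def
  proof (intro allI conjI)
    fix i
    show "x (i + 6) = x i"
      by (simp add: x_def)
    have "(i + 2) mod 6 \<noteq> i mod 6"
      by presburger
    then show "x (i + 2) \<noteq> x i"
      using xs(1,2) by (simp add: x_def nth_eq_iff_index_eq)
    show "adj (x i) (x (Suc i))"
      using edges[of i] assms(2) edges_hex_graph_mono[OF assms(3)]
      unfolding adj_def subgraph_def by blast
  qed
  ultimately show thesis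
    using that by blast
qed

theorem theorem2p21:
  fixes K :: "complex set" and C :: "complex ugraph" and f :: "complex \<Rightarrow> complex"
  assumes "coronoid K"
    and "is_cycle 6 C" and "subgraph C (hex_graph K)"
    and "f \<in> embeddings C (hex_graph hexagons)"
  shows "\<exists>!g. g \<in> embeddings (hex_graph K) (hex_graph hexagons) \<and> (\<forall>v\<in>verts C. g v = f v)"
proof -
  let ?G = "hex_graph K" and ?H = "hex_graph hexagons"
  have K: "K \<subseteq> hexagons" "hex_connected K"
    using assms(1) by (auto simp: coronoid_def)
  obtain x where x: "hex_walk x" "range x = verts C" and edges: "\<And>i. {x i, x (Suc i)} \<in> edges C"
    using cycle6_walk assms(2,3) K(1) by blast
  have sub: "verts C \<subseteq> verts ?G" "edges C \<subseteq> edges ?G"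
    using assms(3) by (auto simp: subgraph_def)
  have fx: "hex_walk (f \<circ> x)"
    using embedding_hex_walk[OF assms(4) x(1) edges] x(2) by simp
  have path: "adj (y 0) (y 1)" "adj (y 1) (y 2)" "y 0 \<noteq> y 2" if "hex_walk y" for y
    using that unfolding hex_walk_def by (metis One_nat_def add_0 numeral_2_eq_2)+
  \<comment> \<open>Matching three consecutive vertices suffices: the images of \<open>x\<close>
    under \<open>A\<close> and under \<open>f\<close> are both closed walks of length six.\<close>
  obtain A where A: "hex_aut A" "A (x 0) = (f \<circ> x) 0" "A (x 1) = (f \<circ> x) 1" "A (x 2) = (f \<circ> x) 2"
    using hex_aut_transitive[OF path[OF x(1)] path[OF fx]] by blast
  define g where "g = restrict A (verts ?G)"
  have g: "g \<in> embeddings ?G ?H"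
    unfolding g_def using hex_aut_embedding[OF A(1) K(1)] .
  have "range x \<subseteq> verts ?G"
    using x(2) sub by simp
  then have gx: "hex_walk (g \<circ> x)" and gA: "g (x i) = A (x i)" for i
    using embedding_hex_walk[OF g x(1)] edges sub by (auto simp: g_def)
  have "(g \<circ> x) i = (f \<circ> x) i" for i
    using A(2-4) hex_walk_eqI[OF gx fx] by (simp add: gA)
  then have "\<forall>v\<in>verts C. g v = f v"
    using x(2) by (metis comp_apply imageE)
  \<comment> \<open>Any other extension agrees with \<open>g\<close> on all of \<open>C\<close>, in
    particular on the path \<open>x 0\<close>, \<open>x 1\<close>, \<open>x 2\<close>.\<close>
  moreover have "h = g"
    if "h \<in> embeddings ?G ?H" "\<forall>v\<in>verts C. h v = f v" for h
  proof (rule embeddings_agree_path[OF that(1) g K(2,1)])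
    show "{x 0, x 1} \<in> edges ?G" "{x 1, x 2} \<in> edges ?G"
      using edges[of 0] edges[of 1] sub(2) by (auto simp: numeral_2_eq_2)
    show "x 0 \<noteq> x 2"
      using path(3)[OF x(1)] .
    show "h (x 0) = g (x 0)" "h (x 1) = g (x 1)" "h (x 2) = g (x 2)"
      using that(2) \<open>\<forall>v\<in>verts C. g v = f v\<close> x(2) by (metis rangeI)+
  qed
  ultimately show ?thesis
    using g by blast
qed

end
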